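(* Let $m\ge 3$ and let $\mathsf S(\mathbf d^m)$ be the numerical semigroup minimally generated by $\mathbf d^m=\{d_1,\dots,d_m\}$, $\gcd(d_1,\dots,d_m)=1$, with Hilbert series $$H(\mathbf d^m;z)=\sum_{s\in\mathsf S(\mathbf d^m)}z^s=\frac{Q(\mathbf d^m;z)}{\prod_{i=1}^m(1-z^{d_i})},\qquad Q(\mathbf d^m;z)=1+\sum_{i=1}^{m-1}(-1)^i\sum_{j=1}^{\beta_i(\mathbf d^m)}z^{C_{j,i}},$$ where $\beta_i(\mathbf d^m)$ are the Betti numbers and $C_{j,i}$ the degrees of the syzygies of the $i$th kind. Then $$\sum_{j=1}^{\beta_1(\mathbf d^m)}C_{j,1}^r-\sum_{j=1}^{\beta_2(\mathbf d^m)}C_{j,2}^r+\ldots+(-1)^m\sum_{j=1}^{\beta_{m-1}(\mathbf d^m)}C_{j,m-1}^r=0,\qquad r=1,\dots,m-2,$$ and $$\sum_{j=1}^{\beta_1(\mathbf d^m)}C_{j,1}^{m-1}-\sum_{j=1}^{\beta_2(\mathbf d^m)}C_{j,2}^{m-1}+\ldots+(-1)^m\sum_{j=1}^{\beta_{m-1}(\mathbf d^m)}C_{j,m-1}^{m-1}=(-1)^m(m-1)!\prod_{i=1}^m d_i .$$ (The sum over the $i$th syzygies enters with sign $(-1)^{i-1}$.)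
   Context: $\mathsf S(\mathbf d^m)=\{\sum_{i=1}^m x_id_i : x_i\in\mathbb Z_{\ge0}\}$ is a numerical semigroup generated by a minimal set of positive integers $d_1<\dots<d_m$ with $\gcd(d_1,\dots,d_m)=1$; minimal means that no $d_i$ is a nonnegative integer combination of the others. Its Hilbert series is a rational function $Q(\mathbf d^m;z)/\prod_{i=1}^m(1-z^{d_i})$ with polynomial numerator $Q=1-Q_1+Q_2-\dots+(-1)^{m-1}Q_{m-1}$, $Q_i=\sum_{j=1}^{\beta_i(\mathbf d^m)}z^{C_{j,i}}$. Here $\beta_i(\mathbf d^m)$ is the $i$th Betti number and the positive integers $C_{j,i}$, $1\le j\le\beta_i(\mathbf d^m)$ (listed with multiplicity, in nondecreasing order in $j$), are the degrees of the syzygies of the $i$th kind in a minimal free resolution of the semigroup ring. The convention is that all cancellations of terms $z^{C_{j,i}}$ with opposite signs in $Q$ are already performed, i.e. $C_{j,i}\ne C_{r,i+2k-1}$ for $1\le k\le\lfloor (m-i)/2\rfloor$. *)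

theory Defs
  imports
    "HOL-Library.Poly_Mapping"
    "HOL-Library.Multiset"
    "HOL-Computational_Algebra.Computational_Algebra"
begin

section \<open>Numerical semigroups and their Hilbert series\<close>

definition semigroup_gen :: "nat \<Rightarrow> (nat \<Rightarrow> nat) \<Rightarrow> nat set" where
  "semigroup_gen m d = {\<Sum>i=1..m. x i * d i | x. True}"

definition minimal_generators :: "nat \<Rightarrow> (nat \<Rightarrow> nat) \<Rightarrow> bool" where
  "minimal_generators m d \<longleftrightarrow>
     (\<forall>i\<in>{1..m}. d i > 0) \<and>
     strict_mono_on {1..m} d \<and>
     Gcd (d ` {1..m}) = 1 \<and>
     (\<forall>i\<in>{1..m}. \<not> (\<exists>x :: nat \<Rightarrow> nat. d i = (\<Sum>j\<in>{1..m} - {i}. x j * d j)))"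

definition hilbert_series :: "nat \<Rightarrow> (nat \<Rightarrow> nat) \<Rightarrow> rat fps" where
  "hilbert_series m d = Abs_fps (\<lambda>s. if s \<in> semigroup_gen m d then 1 else 0)"

definition numerator :: "nat \<Rightarrow> (nat \<Rightarrow> nat) \<Rightarrow> (nat \<Rightarrow> nat \<Rightarrow> nat) \<Rightarrow> rat poly" where
  "numerator m \<beta> C = 1 + (\<Sum>i=1..m-1. (-1)^i * (\<Sum>j=1..\<beta> i. monom 1 (C j i)))"

section \<open>The semigroup ring as a graded module over the polynomial ring\<close>

text \<open>
  A polynomial maps exponent vectors to coefficients. The ring \<open>R = k[x\<^sub>1, \<dots>, x\<^sub>m]\<close>, with
  \<open>x\<^sub>i\<close> of degree \<open>d i\<close>, is the subring of those polynomials that use only variables with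
  index in \<open>{1..m}\<close>.
\<close>

type_synonym 'k mpolynomial = "(nat \<Rightarrow>\<^sub>0 nat) \<Rightarrow>\<^sub>0 'k"

definition poly_ring :: "nat \<Rightarrow> 'k::field mpolynomial set" where
  "poly_ring m = {p. \<forall>t\<in>Poly_Mapping.keys p. Poly_Mapping.keys t \<subseteq> {1..m}}"

definition weight :: "(nat \<Rightarrow> nat) \<Rightarrow> (nat \<Rightarrow>\<^sub>0 nat) \<Rightarrow> nat" where
  "weight d t = (\<Sum>i\<in>Poly_Mapping.keys t. Poly_Mapping.lookup t i * d i)"

text \<open>The \<open>k\<close>-algebra homomorphism \<open>R \<rightarrow> k[z]\<close> with \<open>x\<^sub>i \<mapsto> z^(d i)\<close>; it makes \<open>k[S]\<close> an \<open>R\<close>-module.\<close>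

definition augmentation :: "(nat \<Rightarrow> nat) \<Rightarrow> 'k::field mpolynomial \<Rightarrow> 'k poly" where
  "augmentation d p = (\<Sum>t\<in>Poly_Mapping.keys p. monom (Poly_Mapping.lookup p t) (weight d t))"

definition semigroup_ring :: "nat \<Rightarrow> (nat \<Rightarrow> nat) \<Rightarrow> 'k::field poly set" where
  "semigroup_ring m d = {q. \<forall>n. coeff q n \<noteq> 0 \<longrightarrow> n \<in> semigroup_gen m d}"

section \<open>Minimal graded free resolutions\<close>

text \<open>\<open>R^n\<close>, with coordinates indexed by \<open>{1..n}\<close> and vectors extended by 0.\<close>

definition free_module :: "nat \<Rightarrow> nat \<Rightarrow> (nat \<Rightarrow> 'k::field mpolynomial) set" where
  "free_module m n = {v. (\<forall>j\<in>{1..n}. v j \<in> poly_ring m) \<and> (\<forall>j. j \<notin> {1..n} \<longrightarrow> v j = 0)}"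

definition mat_apply ::
  "nat \<Rightarrow> (nat \<Rightarrow> nat \<Rightarrow> 'k::field mpolynomial) \<Rightarrow> (nat \<Rightarrow> 'k mpolynomial) \<Rightarrow> nat \<Rightarrow> 'k mpolynomial"
where
  "mat_apply n M v = (\<lambda>j. \<Sum>l=1..n. M j l * v l)"

text \<open>
  \<open>M\<close> is the matrix of a degree-preserving homomorphism from the sum of the \<open>R(-E l)\<close>,
  \<open>l \<in> {1..n}\<close>, to the sum of the \<open>R(-D j)\<close>, \<open>j \<in> {1..n'}\<close>: the entry in row \<open>j\<close> and
  column \<open>l\<close> is homogeneous of degree \<open>E l - D j\<close> (so 0 if this is negative).
\<close>

definition graded_matrix ::
  "nat \<Rightarrow> (nat \<Rightarrow> nat) \<Rightarrow> nat \<Rightarrow> (nat \<Rightarrow> nat) \<Rightarrow> nat \<Rightarrow> (nat \<Rightarrow> nat)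
    \<Rightarrow> (nat \<Rightarrow> nat \<Rightarrow> 'k::field mpolynomial) \<Rightarrow> bool"
where
  "graded_matrix m d n' D n E M \<longleftrightarrow>
     (\<forall>j\<in>{1..n'}. \<forall>l\<in>{1..n}. M j l \<in> poly_ring m \<and> (\<forall>t\<in>Poly_Mapping.keys (M j l). weight d t + D j = E l)) \<and>
     (\<forall>j l. j \<notin> {1..n'} \<or> l \<notin> {1..n} \<longrightarrow> M j l = 0)"

text \<open>
  \<open>0 \<rightarrow> F\<^bsub>m-1\<^esub> \<rightarrow> \<dots> \<rightarrow> F\<^sub>1 \<rightarrow> F\<^sub>0 = R \<rightarrow> k[S] \<rightarrow> 0\<close> is exact, where \<open>F\<^sub>i\<close> is the sum of the
  \<open>R(-D j i)\<close>, \<open>j \<in> {1..b i}\<close>, and \<open>A i\<close> is the matrix of \<open>F\<^sub>i \<rightarrow> F\<^bsub>i-1\<^esub>\<close>. Minimality says that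
  all matrix entries lie in the ideal \<open>(x\<^sub>1, \<dots>, x\<^sub>m)\<close>, i.e. have constant term 0. The length
  is at most \<open>m - 1\<close> because \<open>k[S]\<close> has depth 1 (Auslander-Buchsbaum).
\<close>

definition minimal_free_resolution ::
  "nat \<Rightarrow> (nat \<Rightarrow> nat) \<Rightarrow> (nat \<Rightarrow> nat) \<Rightarrow> (nat \<Rightarrow> nat \<Rightarrow> nat)
    \<Rightarrow> (nat \<Rightarrow> nat \<Rightarrow> nat \<Rightarrow> 'k::field mpolynomial) \<Rightarrow> bool"
where
  "minimal_free_resolution m d b D A \<longleftrightarrow>
     b 0 = 1 \<and> D 1 0 = 0 \<and> (\<forall>i\<ge>m. b i = 0) \<and>
     (\<forall>i\<ge>1. graded_matrix m d (b (i-1)) (\<lambda>j. D j (i-1)) (b i) (\<lambda>j. D j i) (A i)) \<and>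
     (\<forall>i\<ge>1. \<forall>j l. Poly_Mapping.lookup (A i j l) 0 = 0) \<and>
     augmentation d ` poly_ring m = (semigroup_ring m d :: 'k poly set) \<and>
     {v \<in> free_module m (b 0). augmentation d (v 1) = 0} =
       mat_apply (b 1) (A 1) ` free_module m (b 1) \<and>
     (\<forall>i\<ge>1. {v \<in> free_module m (b i). mat_apply (b i) (A i) v = (\<lambda>_. 0)} =
       mat_apply (b (i+1)) (A (i+1)) ` free_module m (b (i+1)))"

section \<open>Degrees of syzygies and cancellation in the numerator\<close>

definition syzygy_degrees :: "nat \<Rightarrow> (nat \<Rightarrow> nat) \<Rightarrow> (nat \<Rightarrow> nat \<Rightarrow> nat) \<Rightarrow> nat \<Rightarrow> nat multiset" where
  "syzygy_degrees m \<beta> C =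
     (\<lambda>i. if i \<in> {1..m-1} then image_mset (\<lambda>j. C j i) (mset_set {1..\<beta> i}) else {#})"

text \<open>
  The terms of degree \<open>c\<close> coming from the \<open>i\<close>th and \<open>i'\<close>th syzygies have opposite signs in
  the numerator iff \<open>i + i'\<close> is odd.
\<close>

definition cancel_step :: "(nat \<Rightarrow> nat multiset) \<Rightarrow> (nat \<Rightarrow> nat multiset) \<Rightarrow> bool" where
  "cancel_step X Y \<longleftrightarrow>
     (\<exists>i i' c. odd (i + i') \<and> c \<in># X i \<and> c \<in># X i' \<and>
        Y = X(i := X i - {#c#}, i' := X i' - {#c#}))"

definition no_cancellation :: "nat \<Rightarrow> (nat \<Rightarrow> nat multiset) \<Rightarrow> bool" where
  "no_cancellation m X \<longleftrightarrow>
     (\<forall>i\<in>{1..m-1}. \<forall>k\<in>{1..(m - i) div 2}. \<forall>c. c \<in># X i \<longrightarrow> c \<notin># X (i + 2*k - 1))"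

definition fully_cancelled ::
  "nat \<Rightarrow> (nat \<Rightarrow> nat multiset) \<Rightarrow> (nat \<Rightarrow> nat multiset) \<Rightarrow> bool" where
  "fully_cancelled m X Y \<longleftrightarrow> cancel_step\<^sup>*\<^sup>* X Y \<and> no_cancellation m Y"

end

theory Submission
  imports
    Defs
    "HOL-Library.Function_Algebras"
    "HOL-Number_Theory.Cong"
begin

text \<open>
  Write \<open>H\<close> for the Hilbert series, \<open>Q\<close> for the numerator and \<open>\<theta> = z d/dz\<close> for the Euler operator.
  Since \<open>\<theta> z^c = c z^c\<close>, the alternating sum of \<open>r\<close>th powers of the syzygy degrees is
  \<open>-(\<theta>^r Q)(1)\<close> for \<open>r \<ge> 1\<close>. So the theorem describes how \<open>Q\<close> vanishes at 1, and this can be read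
  off from \<open>Q = H \<Prod>(1 - z^(d i))\<close>.

  A numerical semigroup contains all large integers (\<open>semigroup_gen_contains_large_multiples\<close>), so
  \<open>H\<close> differs from \<open>1/(1 - z)\<close> by a polynomial: it has a simple pole at 1, and \<open>(1 - z) H\<close> is a
  polynomial with value 1 there. Each factor \<open>1 - z^(d i)\<close> is \<open>1 - z\<close> times a polynomial with value
  \<open>d i\<close> at 1. Hence \<open>Q = (1 - z)^(m-1) G\<close> with \<open>G(1) = \<Prod> d i\<close>
  (\<open>numerator_vanishes_to_order\<close>). Applying \<open>\<theta>\<close> lowers the order of a zero at 1 by one and multiplies
  the leading value by minus that order, so \<open>\<theta>^r Q\<close> vanishes at 1 for \<open>r < m - 1\<close>, and
  \<open>(\<theta>^(m-1) Q)(1) = (-1)^(m-1) (m-1)! \<Prod> d i\<close> (\<open>euler_funpow_at_zero_of_order\<close>).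

  The identity \<open>Q = H \<Prod>(1 - z^(d i))\<close> is a count of dimensions. In each degree \<open>n\<close> the free
  resolution restricts to an exact sequence of finite-dimensional vector spaces
  (\<open>exact_on_graded_pieces\<close>), whose alternating sum of dimensions is 1 or 0 according to whether
  \<open>n \<in> S\<close> (\<open>hilbert_function_of_resolution\<close>). The degree \<open>n\<close> piece of \<open>R(-c)\<close> has a basis of
  monomials, and the generating function of the monomials by weight is \<open>1/\<Prod>(1 - z^(d i))\<close>
  (\<open>polynomial_ring_hilbert_series\<close>). Finally, cancelling terms of opposite sign leaves \<open>Q\<close> unchanged
  (\<open>cancellation_preserves_signed_degree_sum\<close>), so the degrees may be taken before or after
  cancellation.
\<close>

section \<open>Rank and nullity\<close>

text \<open>
  The coordinates of \<open>x\<close> with respect to \<open>C\<close> are supported in \<open>B\<close> and also in its complement.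
\<close>
lemma (in vector_space) independent_split_span_Int:
  assumes "independent C" "B \<subseteq> C" "x \<in> span B" "x \<in> span (C - B)"
  shows "x = 0"
proof -
  have "representation C x = representation B x" "representation C x = representation (C - B) x"
    using assms by (auto intro: representation_extend)
  then have "representation C x b = 0" for b
    using representation_ne_zero[of B x b] representation_ne_zero[of "C - B" x b] by fastforce
  moreover have "x \<in> span C"
    using assms span_mono by blast
  ultimately show ?thesis
    using sum_nonzero_representation_eq[OF assms(1), of x] by simp
qed

text \<open>
  The ambient spaces of polynomial vectors are infinite-dimensional, so only \<open>V\<close> is assumed to be
  finitely spanned. A basis \<open>B\<close> of the kernel is extended to a basis \<open>C\<close> of \<open>V\<close>; then \<open>f\<close> is injective on
  the span of \<open>C - B\<close> and maps \<open>C - B\<close> to a basis of the image.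
\<close>
lemma (in Vector_Spaces.linear) rank_nullity:
  assumes V: "vs1.subspace V" and W: "V \<subseteq> vs1.span W" "finite W"
  shows "vs1.dim V = vs1.dim {v \<in> V. f v = 0} + vs2.dim (f ` V)"
proof -
  let ?K = "{v \<in> V. f v = 0}"
  obtain B where B: "B \<subseteq> ?K" "vs1.independent B" "?K \<subseteq> vs1.span B" "card B = vs1.dim ?K"
    by (rule vs1.basis_exists)
  have "B \<subseteq> V"
    using B(1) by auto
  then obtain C where C: "B \<subseteq> C" "C \<subseteq> V" "vs1.independent C" "V \<subseteq> vs1.span C"
    using vs1.maximal_independent_subset_extend B(2) by blast
  have fin: "finite C"
    using vs1.independent_span_bound[OF W(2) C(3)] C(2) W(1) by auto
  have spanC: "vs1.span C = V"
    using C(2,4) V by (rule vs1.span_subspace)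
  have "x = 0" if x: "x \<in> vs1.span (C - B)" "f x = 0" for x
  proof -
    have "x \<in> V"
      using x(1) spanC vs1.span_mono[of "C - B" C] by blast
    then have "x \<in> vs1.span B"
      using x(2) B(3) by auto
    then show ?thesis
      using vs1.independent_split_span_Int[OF C(3,1)] x(1) by blast
  qed
  then have inj: "inj_on f (vs1.span (C - B))"
    by (subst inj_on_iff_eq_0) auto
  have ind: "vs2.independent (f ` (C - B))"
    using inj C(3) vs1.independent_mono by (intro independent_injective_image) auto
  have "f ` C \<subseteq> insert 0 (f ` (C - B))"
    using B(1) by auto
  then have "vs2.span (f ` C) \<subseteq> vs2.span (f ` (C - B))"
    using vs2.span_mono vs2.span_insert_0 by metis
  moreover have "vs2.span (f ` (C - B)) \<subseteq> vs2.span (f ` C)"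
    by (intro vs2.span_mono) auto
  ultimately have "vs2.span (f ` (C - B)) = vs2.span (f ` V)"
    using spanC span_image by (metis subset_antisym vs2.span_span)
  then have "vs2.dim (f ` V) = card (f ` (C - B))"
    using ind by (rule vs2.dim_eq_card)
  also have "\<dots> = card (C - B)"
    by (intro card_image inj_on_subset[OF inj] vs1.span_superset)
  also have "\<dots> = card C - card B"
    using fin C(1) by (intro card_Diff_subset) (auto intro: finite_subset)
  finally show ?thesis
    using vs1.basis_card_eq_dim[OF C(2,4,3)] card_mono[OF fin C(1)] B(4) by simp
qed

section \<open>Monomials of a given weight\<close>

lemma weight_eq_sum:
  "finite K \<Longrightarrow> Poly_Mapping.keys t \<subseteq> K \<Longrightarrow> weight d t = (\<Sum>i\<in>K. Poly_Mapping.lookup t i * d i)"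
  unfolding weight_def by (rule sum.mono_neutral_left) (auto simp: in_keys_iff)

lemma weight_add: "weight d (s + t) = weight d s + weight d t"
proof -
  let ?K = "Poly_Mapping.keys s \<union> Poly_Mapping.keys t"
  have "weight d u = (\<Sum>i\<in>?K. Poly_Mapping.lookup u i * d i)" if "u \<in> {s, t, s + t}" for u
    using that Poly_Mapping.keys_add[of s t] by (intro weight_eq_sum) auto
  then show ?thesis
    by (simp add: lookup_add sum.distrib distrib_right)
qed

lemma weight_single: "weight d (Poly_Mapping.single i a) = a * d i"
  by (subst weight_eq_sum[of "{i}"]) auto

definition monomials :: "nat \<Rightarrow> (nat \<Rightarrow> nat) \<Rightarrow> nat \<Rightarrow> (nat \<Rightarrow>\<^sub>0 nat) set" where
  "monomials m d n = {t. Poly_Mapping.keys t \<subseteq> {1..m} \<and> weight d t = n}"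

text \<open>
  Because the \<open>d i\<close> are positive, an exponent is at most the weight.
\<close>
lemma finite_monomials:
  assumes "\<forall>i\<in>{1..m}. d i > 0"
  shows "finite (monomials m d n)"
proof (rule finite_imageD)
  have "Poly_Mapping.lookup t i \<le> n" if "t \<in> monomials m d n" "i \<in> {1..m}" for t i
  proof -
    have "Poly_Mapping.lookup t i \<le> Poly_Mapping.lookup t i * d i"
      using bspec[OF assms that(2)] by simp
    also have "\<dots> \<le> (\<Sum>i\<in>{1..m}. Poly_Mapping.lookup t i * d i)"
      by (rule member_le_sum) (use that(2) in auto)
    also have "\<dots> = n"
      using that(1) weight_eq_sum[of "{1..m}" t d] by (simp add: monomials_def)
    finally show ?thesis .
  qed
  then have "Poly_Mapping.lookup ` monomials m d n \<subseteq>
      {f. \<forall>i. (i \<in> {1..m} \<longrightarrow> f i \<in> {..n}) \<and> (i \<notin> {1..m} \<longrightarrow> f i = 0)}"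
    by (auto simp: monomials_def in_keys_iff)
  then show "finite (Poly_Mapping.lookup ` monomials m d n)"
    by (rule finite_subset) (intro finite_set_of_finite_funs; simp)
qed (simp add: inj_on_def poly_mapping_eqI)

text \<open>
  A monomial either avoids the last variable or is that variable times a monomial of smaller weight.
  As an identity of generating functions this says that a new variable contributes the factor
  \<open>1/(1 - z^(d (Suc m)))\<close>.
\<close>
lemma card_monomials_Suc:
  assumes "\<forall>i\<in>{1..Suc m}. d i > 0"
  shows "card (monomials (Suc m) d n) = card (monomials m d n) +
    (if d (Suc m) \<le> n then card (monomials (Suc m) d (n - d (Suc m))) else 0)"
proof -
  let ?x = "Poly_Mapping.single (Suc m) (1 :: nat)"
  let ?Y = "if d (Suc m) \<le> n then monomials (Suc m) d (n - d (Suc m)) else {}"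
  have "monomials (Suc m) d n = monomials m d n \<union> (\<lambda>t. t + ?x) ` ?Y"
  proof (intro equalityI subsetI)
    fix t assume t: "t \<in> monomials (Suc m) d n"
    show "t \<in> monomials m d n \<union> (\<lambda>t. t + ?x) ` ?Y"
    proof (cases "Suc m \<in> Poly_Mapping.keys t")
      case False
      then show ?thesis
        using t by (auto simp: monomials_def le_Suc_eq)
    next
      case True
      then have pos: "Poly_Mapping.lookup t (Suc m) > 0"
        by (simp add: in_keys_iff)
      have eq: "t = t - ?x + ?x"
        using pos by (intro poly_mapping_eqI) (auto simp: lookup_add lookup_minus lookup_single when_def)
      have "n = weight d (t - ?x) + d (Suc m)"
        using t weight_add[of d "t - ?x" ?x] eq by (simp add: monomials_def weight_single)
      moreover have "Poly_Mapping.keys (t - ?x) \<subseteq> {1..Suc m}"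
        using t by (auto simp: monomials_def in_keys_iff lookup_minus)
      ultimately have "t - ?x \<in> ?Y"
        by (auto simp: monomials_def)
      then show ?thesis
        using eq by blast
    qed
  next
    fix t assume "t \<in> monomials m d n \<union> (\<lambda>t. t + ?x) ` ?Y"
    then consider "t \<in> monomials m d n" | u where "u \<in> ?Y" "t = u + ?x"
      by blast
    then show "t \<in> monomials (Suc m) d n"
    proof cases
      case 1
      then show ?thesis
        by (auto simp: monomials_def)
    next
      case 2
      then show ?thesis
        using Poly_Mapping.keys_add[of u ?x] by (fastforce simp: monomials_def weight_add weight_single split: if_splits)
    qed
  qed
  moreover have "Suc m \<in> Poly_Mapping.keys (t + ?x)" for t
    by (simp add: in_keys_iff lookup_add)
  then have "monomials m d n \<inter> (\<lambda>t. t + ?x) ` ?Y = {}"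
    by (fastforce simp: monomials_def)
  moreover have "finite (monomials m d n)" "finite ?Y"
    using assms finite_monomials by auto
  ultimately have "card (monomials (Suc m) d n) = card (monomials m d n) + card ((\<lambda>t. t + ?x) ` ?Y)"
    by (simp only: card_Un_disjoint finite_imageI)
  also have "card ((\<lambda>t. t + ?x) ` ?Y) = card ?Y"
    by (intro card_image) simp
  finally show ?thesis
    by simp
qed

lemma polynomial_ring_hilbert_series:
  assumes "\<forall>i\<in>{1..m}. d i > 0"
  shows "Abs_fps (\<lambda>n. of_nat (card (monomials m d n))) * (\<Prod>i=1..m. 1 - fps_X ^ d i) = (1 :: rat fps)"
  using assms
proof (induction m)
  case 0
  have "monomials 0 d n = (if n = 0 then {0} else {})" for n
    by (auto simp: monomials_def weight_def)
  then show ?case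
    by (intro fps_ext) simp
next
  case (Suc m)
  let ?P = "\<lambda>m. Abs_fps (\<lambda>n. of_nat (card (monomials m d n))) :: rat fps"
  have "?P (Suc m) * (1 - fps_X ^ d (Suc m)) = ?P m"
    using card_monomials_Suc[OF Suc.prems]
    by (intro fps_ext) (simp add: right_diff_distrib fps_X_power_mult_right_nth not_le[symmetric])
  then have "?P (Suc m) * (\<Prod>i=1..Suc m. 1 - fps_X ^ d i) = ?P m * (\<Prod>i=1..m. 1 - fps_X ^ d i)"
    by (simp add: mult_ac)
  also have "\<dots> = 1"
    using Suc by simp
  finally show ?case .
qed

lemma semigroup_gen_iff_monomials: "n \<in> semigroup_gen m d \<longleftrightarrow> monomials m d n \<noteq> {}"
proof
  assume "n \<in> semigroup_gen m d"
  then obtain x where x: "n = (\<Sum>i=1..m. x i * d i)"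
    by (auto simp: semigroup_gen_def)
  define t where "t = (\<Sum>i=1..m. Poly_Mapping.single i (x i))"
  have t: "Poly_Mapping.lookup t i = (if i \<in> {1..m} then x i else 0)" for i
    by (simp add: t_def lookup_sum lookup_single when_def sum.delta')
  have "Poly_Mapping.keys t \<subseteq> {1..m}"
    by (auto simp: in_keys_iff t split: if_splits)
  then have "t \<in> monomials m d n"
    using weight_eq_sum[of "{1..m}" t d] by (simp add: monomials_def x t)
  then show "monomials m d n \<noteq> {}"
    by blast
next
  assume "monomials m d n \<noteq> {}"
  then obtain t where "Poly_Mapping.keys t \<subseteq> {1..m}" "weight d t = n"
    by (auto simp: monomials_def)
  then show "n \<in> semigroup_gen m d"
    using weight_eq_sum[of "{1..m}" t d] unfolding semigroup_gen_def by auto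
qed

section \<open>Homogeneous parts of vectors of polynomials\<close>

lift_definition restrict_keys :: "('a \<Rightarrow> bool) \<Rightarrow> ('a \<Rightarrow>\<^sub>0 'b::zero) \<Rightarrow> ('a \<Rightarrow>\<^sub>0 'b)"
  is "\<lambda>P f t. if P t then f t else 0"
  by (rule finite_subset) auto

lemma keys_restrict_keys: "Poly_Mapping.keys (restrict_keys P p) = {t \<in> Poly_Mapping.keys p. P t}"
  by (auto simp: in_keys_iff restrict_keys.rep_eq split: if_splits)

lemma restrict_keys_add: "restrict_keys P (p + q) = restrict_keys P p + restrict_keys P q"
  for p q :: "'a \<Rightarrow>\<^sub>0 'b::monoid_add"
  by (rule poly_mapping_eqI) (simp add: restrict_keys.rep_eq lookup_add)

lemma restrict_keys_sum: "restrict_keys P (sum f A) = (\<Sum>a\<in>A. restrict_keys P (f a))"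
  for f :: "'c \<Rightarrow> 'a \<Rightarrow>\<^sub>0 'b::comm_monoid_add"
  by (rule poly_mapping_eqI) (simp add: restrict_keys.rep_eq lookup_sum)

lemma restrict_keys_id_iff: "restrict_keys P p = p \<longleftrightarrow> (\<forall>t\<in>Poly_Mapping.keys p. P t)"
  by (auto simp: poly_mapping_eq_iff fun_eq_iff restrict_keys.rep_eq in_keys_iff)

lemma restrict_keys_eq_0: "(\<And>t. t \<in> Poly_Mapping.keys p \<Longrightarrow> \<not> P t) \<Longrightarrow> restrict_keys P p = 0"
  by (auto simp: poly_mapping_eq_iff fun_eq_iff restrict_keys.rep_eq in_keys_iff)

lemma restrict_keys_0 [simp]: "restrict_keys P 0 = 0"
  by (rule restrict_keys_eq_0) simp

lemma restrict_keys_split: "p = restrict_keys P p + restrict_keys (\<lambda>t. \<not> P t) p"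
  for p :: "'a \<Rightarrow>\<^sub>0 'b::monoid_add"
  by (rule poly_mapping_eqI) (simp add: restrict_keys.rep_eq lookup_add)

text \<open>
  Multiplication by a homogeneous \<open>f\<close> of degree \<open>e - a\<close> shifts degrees. Adding \<open>a\<close> to weights
  avoids the natural-number difference, which would be truncated for \<open>e < a\<close>.
\<close>
lemma restrict_keys_mult_homogeneous:
  fixes f p :: "'k::field mpolynomial"
  assumes f: "\<And>t. t \<in> Poly_Mapping.keys f \<Longrightarrow> weight d t + a = e"
  shows "restrict_keys (\<lambda>t. weight d t + a = n) (f * p) = f * restrict_keys (\<lambda>t. weight d t + e = n) p"
proof -
  let ?P = "\<lambda>t. weight d t + a = n" and ?R = "\<lambda>t. weight d t + e = n"
  have weights: "\<exists>u\<in>Poly_Mapping.keys q. weight d t + a = weight d u + e"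
    if t: "t \<in> Poly_Mapping.keys (f * q)" for t q
  proof -
    obtain s u where "s \<in> Poly_Mapping.keys f" "u \<in> Poly_Mapping.keys q" "t = s + u"
      using t keys_mult[of f q] by blast
    with f[of s] show ?thesis
      by (intro bexI[of _ u]) (auto simp: weight_add)
  qed
  have "f * p = f * restrict_keys ?R p + f * restrict_keys (\<lambda>t. \<not> ?R t) p"
    by (metis distrib_left restrict_keys_split)
  moreover have "restrict_keys ?P (f * restrict_keys ?R p) = f * restrict_keys ?R p"
    unfolding restrict_keys_id_iff using weights[of _ "restrict_keys ?R p"] by (fastforce simp: keys_restrict_keys)
  moreover have "restrict_keys ?P (f * restrict_keys (\<lambda>t. \<not> ?R t) p) = 0"
    using weights[of _ "restrict_keys (\<lambda>t. \<not> ?R t) p"]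
    by (intro restrict_keys_eq_0) (fastforce simp: keys_restrict_keys)
  ultimately show ?thesis
    by (simp add: restrict_keys_add)
qed

text \<open>
  The degree \<open>n\<close> part of an element of the sum of the \<open>R(-E j)\<close>: the \<open>j\<close>th generator has degree \<open>E j\<close>.
\<close>
definition homogeneous_part ::
  "(nat \<Rightarrow> nat) \<Rightarrow> (nat \<Rightarrow> nat) \<Rightarrow> nat \<Rightarrow> (nat \<Rightarrow> 'k::field mpolynomial) \<Rightarrow> nat \<Rightarrow> 'k mpolynomial"
where
  "homogeneous_part d E n v = (\<lambda>j. restrict_keys (\<lambda>t. weight d t + E j = n) (v j))"

text \<open>
  Graded homomorphisms commute with the projection to degree \<open>n\<close>. This is what makes an exact
  sequence of graded modules split into exact sequences of graded pieces.
\<close>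
lemma homogeneous_part_mat_apply:
  assumes "graded_matrix m d b' D b E M"
  shows "homogeneous_part d D n (mat_apply b M v) = mat_apply b M (homogeneous_part d E n v)"
proof
  fix j
  have "restrict_keys (\<lambda>t. weight d t + D j = n) (M j l * v l)
      = M j l * restrict_keys (\<lambda>t. weight d t + E l = n) (v l)" if "l \<in> {1..b}" for l
    using assms that by (intro restrict_keys_mult_homogeneous) (cases "j \<in> {1..b'}"; auto simp: graded_matrix_def)
  then show "homogeneous_part d D n (mat_apply b M v) j = mat_apply b M (homogeneous_part d E n v) j"
    by (simp add: homogeneous_part_def mat_apply_def restrict_keys_sum)
qed

lemma homogeneous_part_in_free_module:
  "v \<in> free_module m b \<Longrightarrow> homogeneous_part d E n v \<in> free_module m b"
  by (auto simp: free_module_def poly_ring_def homogeneous_part_def keys_restrict_keys)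

definition graded_piece ::
  "nat \<Rightarrow> (nat \<Rightarrow> nat) \<Rightarrow> nat \<Rightarrow> (nat \<Rightarrow> nat) \<Rightarrow> nat \<Rightarrow> (nat \<Rightarrow> 'k::field mpolynomial) set"
where
  "graded_piece m d b E n = {v \<in> free_module m b. homogeneous_part d E n v = v}"

text \<open>
  The same space described through its monomials, from which a basis can be read off. The condition
  \<open>E j \<le> n\<close> keeps the truncated difference \<open>n - E j\<close> from producing constants.
\<close>
lemma graded_piece_iff:
  "v \<in> graded_piece m d b E n \<longleftrightarrow>
    (\<forall>j. Poly_Mapping.keys (v j) \<subseteq> (if j \<in> {1..b} \<and> E j \<le> n then monomials m d (n - E j) else {}))"
  (is "_ \<longleftrightarrow> (\<forall>j. ?K j)")
proof -
  have iff: "v \<in> graded_piece m d b E n \<longleftrightarrow>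
    (\<forall>j. (j \<in> {1..b} \<longrightarrow> v j \<in> poly_ring m) \<and> (j \<notin> {1..b} \<longrightarrow> v j = 0) \<and>
         (\<forall>t\<in>Poly_Mapping.keys (v j). weight d t + E j = n))" (is "_ \<longleftrightarrow> (\<forall>j. ?H j)")
    by (auto simp: graded_piece_def free_module_def homogeneous_part_def fun_eq_iff restrict_keys_id_iff)
  have "?H j \<longleftrightarrow> ?K j" for j
  proof (cases "j \<in> {1..b} \<and> E j \<le> n")
    case True
    then show ?thesis
      by (auto simp: poly_ring_def monomials_def)
  next
    case False
    have "?H j \<longleftrightarrow> v j = 0"
      using False by (cases "j \<in> {1..b}") (auto simp: poly_ring_def poly_mapping_eq_iff fun_eq_iff in_keys_iff)
    then show ?thesis
      unfolding if_not_P[OF False] by simp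
  qed
  then show ?thesis
    unfolding iff by (intro all_cong1)
qed

text \<open>
  The predicate \<open>P\<close> stands for the kernel of the next map, which is either given by a matrix or is
  the augmentation. A homogeneous element of the image has a homogeneous preimage, namely the
  degree \<open>n\<close> part of any preimage.
\<close>
lemma exact_on_graded_pieces:
  assumes M: "graded_matrix m d b' D b E M"
    and exact: "{v \<in> free_module m b'. P v} = mat_apply b M ` free_module m b"
  shows "{v \<in> graded_piece m d b' D n. P v} = mat_apply b M ` graded_piece m d b E n"
proof (intro equalityI subsetI)
  fix v assume "v \<in> {v \<in> graded_piece m d b' D n. P v}"
  then have v: "v \<in> free_module m b'" "P v" "homogeneous_part d D n v = v"
    by (auto simp: graded_piece_def)
  then obtain u where u: "u \<in> free_module m b" "v = mat_apply b M u"
    using exact by blast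
  have "homogeneous_part d E n u \<in> graded_piece m d b E n"
    using homogeneous_part_in_free_module[OF u(1)]
    by (auto simp: graded_piece_def homogeneous_part_def restrict_keys_id_iff keys_restrict_keys fun_eq_iff)
  moreover have "v = mat_apply b M (homogeneous_part d E n u)"
    using v(3) u(2) homogeneous_part_mat_apply[OF M] by metis
  ultimately show "v \<in> mat_apply b M ` graded_piece m d b E n"
    by blast
next
  fix v assume "v \<in> mat_apply b M ` graded_piece m d b E n"
  then obtain u where u: "u \<in> free_module m b" "homogeneous_part d E n u = u" "v = mat_apply b M u"
    by (auto simp: graded_piece_def)
  then have "homogeneous_part d D n v = v"
    using homogeneous_part_mat_apply[OF M, of n u] by simp
  then show "v \<in> {v \<in> graded_piece m d b' D n. P v}"
    using u exact by (auto simp: graded_piece_def)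
qed

section \<open>Dimensions of graded pieces\<close>

text \<open>
  Scalars act as constant polynomials, that is, as coefficients of the monomial with exponent vector 0.
\<close>
definition scale_vector ::
  "'k::field \<Rightarrow> (nat \<Rightarrow> 'k mpolynomial) \<Rightarrow> nat \<Rightarrow> 'k mpolynomial"
where
  "scale_vector c v = (\<lambda>j. Poly_Mapping.single 0 c * v j)"

lemma lookup_single_0_mult: "Poly_Mapping.lookup (Poly_Mapping.single 0 c * p) t = c * Poly_Mapping.lookup p t"
  for p :: "'k::field mpolynomial"
  by (simp flip: mult_map_scale_conv_mult add: Poly_Mapping.map.rep_eq when_def)

interpretation vec: vector_space "scale_vector :: 'k::field \<Rightarrow> _"
  by unfold_locales (auto simp: scale_vector_def fun_eq_iff distrib_left distrib_right single_add mult_single mult.assoc[symmetric])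

interpretation poly_vec: vector_space "smult :: 'k::field \<Rightarrow> _"
  by unfold_locales (auto simp: smult_add_right smult_add_left)

lemma linear_mat_apply: "Vector_Spaces.linear scale_vector scale_vector (mat_apply b (M :: nat \<Rightarrow> nat \<Rightarrow> 'k::field mpolynomial))"
  by unfold_locales
    (auto simp: scale_vector_def mat_apply_def fun_eq_iff distrib_left sum.distrib sum_distrib_left mult_ac)

lemma augmentation_eq_sum:
  "finite K \<Longrightarrow> Poly_Mapping.keys p \<subseteq> K \<Longrightarrow>
    augmentation d p = (\<Sum>t\<in>K. monom (Poly_Mapping.lookup p t) (weight d t))"
  unfolding augmentation_def by (rule sum.mono_neutral_left) (auto simp: in_keys_iff)

lemma linear_augmentation:
  "Vector_Spaces.linear scale_vector smult (\<lambda>v. augmentation d (v j :: 'k::field mpolynomial))"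
proof unfold_locales
  fix v w :: "nat \<Rightarrow> 'k mpolynomial" and c :: 'k
  let ?K = "Poly_Mapping.keys (v j) \<union> Poly_Mapping.keys (w j)"
  have "augmentation d p = (\<Sum>t\<in>?K. monom (Poly_Mapping.lookup p t) (weight d t))" if "p \<in> {v j, w j, v j + w j}" for p
    using that Poly_Mapping.keys_add[of "v j" "w j"] by (intro augmentation_eq_sum) auto
  then show "augmentation d ((v + w) j) = augmentation d (v j) + augmentation d (w j)"
    by (simp add: lookup_add sum.distrib flip: add_monom)
  have "augmentation d (scale_vector c v j) =
      (\<Sum>t\<in>Poly_Mapping.keys (v j). monom (Poly_Mapping.lookup (scale_vector c v j) t) (weight d t))"
    by (intro augmentation_eq_sum) (auto simp: scale_vector_def in_keys_iff lookup_single_0_mult)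
  then show "augmentation d (scale_vector c v j) = smult c (augmentation d (v j))"
    by (simp add: augmentation_def scale_vector_def lookup_single_0_mult smult_monom poly_vec.scale_sum_right)
qed

lemma subspace_graded_piece: "vec.subspace (graded_piece m d b E n :: (nat \<Rightarrow> 'k::field mpolynomial) set)"
  (is "vec.subspace ?G")
proof (rule vec.subspaceI)
  show "0 \<in> ?G"
    by (simp add: graded_piece_iff)
next
  fix v w :: "nat \<Rightarrow> 'k mpolynomial"
  assume "v \<in> ?G" "w \<in> ?G"
  then show "v + w \<in> ?G"
    unfolding graded_piece_iff plus_fun_apply using Poly_Mapping.keys_add by (meson Un_least order_trans)
next
  fix c and v :: "nat \<Rightarrow> 'k mpolynomial"
  assume "v \<in> ?G"
  moreover have "Poly_Mapping.keys (scale_vector c v j) \<subseteq> Poly_Mapping.keys (v j)" for j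
    by (auto simp: scale_vector_def in_keys_iff lookup_single_0_mult)
  ultimately show "scale_vector c v \<in> ?G"
    unfolding graded_piece_iff by (meson order_trans)
qed

definition monomial_vector :: "nat \<times> (nat \<Rightarrow>\<^sub>0 nat) \<Rightarrow> nat \<Rightarrow> 'k::field mpolynomial" where
  "monomial_vector = (\<lambda>(j, t) j'. if j' = j then Poly_Mapping.single t 1 else 0)"

lemma lookup_sum_monomial_vectors:
  assumes "finite X"
  shows "Poly_Mapping.lookup ((\<Sum>x\<in>X. scale_vector (c x) (monomial_vector x)) j) t = (if (j, t) \<in> X then c (j, t) else 0)"
proof -
  have "(\<Sum>x\<in>X. scale_vector (c x) (monomial_vector x)) j = (\<Sum>x\<in>X. scale_vector (c x) (monomial_vector x) j)"
    using assms by (induction X rule: finite_induct) simp_all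
  moreover have "Poly_Mapping.lookup (scale_vector (c x) (monomial_vector x) j) t = (if x = (j, t) then c (j, t) else 0)" for x
    by (cases x) (auto simp: scale_vector_def monomial_vector_def lookup_single_0_mult lookup_single when_def)
  ultimately show ?thesis
    using assms by (simp add: lookup_sum sum.delta)
qed

lemma inj_monomial_vector: "inj (monomial_vector :: _ \<Rightarrow> nat \<Rightarrow> 'k::field mpolynomial)"
proof (rule injI)
  fix x y :: "nat \<times> (nat \<Rightarrow>\<^sub>0 nat)"
  assume eq: "monomial_vector x = (monomial_vector y :: nat \<Rightarrow> 'k mpolynomial)"
  have "Poly_Mapping.lookup (monomial_vector y (fst x) :: 'k mpolynomial) (snd x) = 1"
    unfolding eq[symmetric] by (cases x) (simp add: monomial_vector_def)
  then show "x = y"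
    by (cases x; cases y) (auto simp: monomial_vector_def lookup_single when_def split: if_splits)
qed

lemma independent_monomial_vectors:
  assumes "finite X"
  shows "vec.independent (monomial_vector ` X :: (nat \<Rightarrow> 'k::field mpolynomial) set)"
proof (rule vec.independent_if_scalars_zero)
  fix f :: "(nat \<Rightarrow> 'k mpolynomial) \<Rightarrow> 'k" and v :: "nat \<Rightarrow> 'k mpolynomial"
  assume sum: "(\<Sum>v\<in>monomial_vector ` X. scale_vector (f v) v) = 0"
    and "v \<in> monomial_vector ` X"
  then obtain j t where v: "v = monomial_vector (j, t)" "(j, t) \<in> X"
    by auto
  have "(\<Sum>x\<in>X. scale_vector (f (monomial_vector x)) (monomial_vector x)) = 0"
    using sum by (subst (asm) sum.reindex) (auto intro: inj_on_subset[OF inj_monomial_vector])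
  then have "Poly_Mapping.lookup ((\<Sum>x\<in>X. scale_vector (f (monomial_vector x)) (monomial_vector x)) j) t = 0"
    by simp
  then show "f v = 0"
    using v by (simp add: lookup_sum_monomial_vectors[OF assms])
qed (use assms in simp)

text \<open>
  The monomials \<open>x^t e_j\<close> of degree \<open>n\<close> form a finite basis.
\<close>
lemma dim_graded_piece:
  assumes "\<forall>i\<in>{1..m}. d i > 0"
  shows "\<exists>W. finite W \<and> (graded_piece m d b E n :: (nat \<Rightarrow> 'k::field mpolynomial) set) \<subseteq> vec.span W"
    and "vec.dim (graded_piece m d b E n :: (nat \<Rightarrow> 'k::field mpolynomial) set) =
      (\<Sum>j=1..b. if E j \<le> n then card (monomials m d (n - E j)) else 0)"
proof -
  let ?G = "graded_piece m d b E n :: (nat \<Rightarrow> 'k::field mpolynomial) set"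
  define T where "T j = (if E j \<le> n then monomials m d (n - E j) else {})" for j
  let ?X = "Sigma {1..b} T"
  let ?B = "monomial_vector ` ?X :: (nat \<Rightarrow> 'k::field mpolynomial) set"
  have T: "finite (T j)" for j
    unfolding T_def using finite_monomials[OF assms] by simp
  then have fin: "finite ?X"
    by blast
  have G: "v \<in> ?G \<longleftrightarrow> (\<forall>j t. t \<in> Poly_Mapping.keys (v j) \<longrightarrow> (j, t) \<in> ?X)" for v
  proof -
    have "(if j \<in> {1..b} \<and> E j \<le> n then monomials m d (n - E j) else {}) = {t. (j, t) \<in> ?X}" for j
      by (auto simp: T_def)
    then show ?thesis
      unfolding graded_piece_iff by (simp only: subset_iff mem_Collect_eq)
  qed
  have "monomial_vector x \<in> ?G" if "x \<in> ?X" for x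
    unfolding G using that by (cases x) (auto simp: monomial_vector_def split: if_splits)
  then have sub: "?B \<subseteq> ?G"
    by blast
  have span: "?G \<subseteq> vec.span ?B"
  proof
    fix v assume v: "v \<in> ?G"
    have "v = (\<Sum>x\<in>?X. scale_vector (Poly_Mapping.lookup (v (fst x)) (snd x)) (monomial_vector x))"
    proof (intro ext poly_mapping_eqI)
      fix j t
      show "Poly_Mapping.lookup (v j) t = Poly_Mapping.lookup
          ((\<Sum>x\<in>?X. scale_vector (Poly_Mapping.lookup (v (fst x)) (snd x)) (monomial_vector x)) j) t"
        unfolding lookup_sum_monomial_vectors[OF fin] using v unfolding G by (auto simp: in_keys_iff)
    qed
    moreover have "\<dots> \<in> vec.span ?B"
      by (intro vec.span_sum vec.span_scale vec.span_base imageI)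
    ultimately show "v \<in> vec.span ?B"
      by simp
  qed
  then show "\<exists>W. finite W \<and> ?G \<subseteq> vec.span W"
    using fin by blast
  have "vec.dim ?G = card ?B"
    using vec.basis_card_eq_dim[OF sub span independent_monomial_vectors[OF fin]] by simp
  also have "\<dots> = card ?X"
    by (intro card_image inj_on_subset[OF inj_monomial_vector]) simp
  also have "\<dots> = (\<Sum>j=1..b. if E j \<le> n then card (monomials m d (n - E j)) else 0)"
    using T by (simp add: card_SigmaI T_def if_distrib cong: if_cong)
  finally show "vec.dim ?G = \<dots>" .
qed

text \<open>
  The augmentation sends every monomial of weight \<open>n\<close> to \<open>z^n\<close>, and such a monomial exists exactly when
  \<open>n\<close> lies in the semigroup. So the degree \<open>n\<close> piece of the semigroup ring has dimension 1 or 0.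
\<close>
lemma dim_augmentation_image:
  assumes "b \<ge> 1" "E 1 = 0"
  shows "poly_vec.dim ((\<lambda>v. augmentation d (v 1)) ` (graded_piece m d b E n :: (nat \<Rightarrow> 'k::field mpolynomial) set)) =
    (if n \<in> semigroup_gen m d then 1 else 0)"
    (is "poly_vec.dim (?\<phi> ` ?G) = _")
proof -
  let ?B = "if n \<in> semigroup_gen m d then {monom (1::'k) n} else {}"
  have "?\<phi> v \<in> poly_vec.span ?B" if v: "v \<in> ?G" for v
  proof -
    have keys: "Poly_Mapping.keys (v 1) \<subseteq> monomials m d n"
      using v[unfolded graded_piece_iff, rule_format, of 1] assms by simp
    have "monom (Poly_Mapping.lookup (v 1) t) (weight d t) \<in> poly_vec.span ?B"
      if "t \<in> Poly_Mapping.keys (v 1)" for t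
    proof -
      have "t \<in> monomials m d n"
        using keys that by blast
      then have "monom (Poly_Mapping.lookup (v 1) t) (weight d t) = smult (Poly_Mapping.lookup (v 1) t) (monom 1 n)"
        "n \<in> semigroup_gen m d"
        by (auto simp: semigroup_gen_iff_monomials monomials_def smult_monom)
      then show ?thesis
        by (auto intro: poly_vec.span_scale poly_vec.span_base)
    qed
    then show ?thesis
      unfolding augmentation_def by (rule poly_vec.span_sum)
  qed
  then have "?\<phi> ` ?G \<subseteq> poly_vec.span ?B"
    by blast
  moreover have "?B \<subseteq> ?\<phi> ` ?G"
  proof (cases "n \<in> semigroup_gen m d")
    case True
    then obtain t where t: "t \<in> monomials m d n"
      by (auto simp: semigroup_gen_iff_monomials)
    then have "monomial_vector (1, t) \<in> ?G"
      using assms by (auto simp: graded_piece_iff monomial_vector_def)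
    moreover have "?\<phi> (monomial_vector (1, t)) = monom 1 n"
      using t by (simp add: monomial_vector_def augmentation_def monomials_def)
    ultimately have "monom 1 n \<in> ?\<phi> ` ?G"
      by (metis (no_types, lifting) image_eqI)
    then show ?thesis
      by simp
  qed simp
  ultimately have "card ?B = poly_vec.dim (?\<phi> ` ?G)"
    by (intro poly_vec.basis_card_eq_dim) (simp_all add: poly_vec.independent_empty)
  then show ?thesis
    by (simp split: if_splits)
qed

section \<open>The Hilbert series from a free resolution\<close>

text \<open>
  The parts of the definition that express a free resolution, re-indexed for the long exact sequence.
\<close>
lemma minimal_free_resolutionD:
  assumes "minimal_free_resolution m d b D A"
  shows "b 0 = 1" and "D 1 0 = 0" and "b m = 0"
    and "\<And>i. graded_matrix m d (b i) (\<lambda>j. D j i) (b (Suc i)) (\<lambda>j. D j (Suc i)) (A (Suc i))"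
    and "{v \<in> free_module m (b 0). augmentation d (v 1) = 0} =
      mat_apply (b 1) (A 1) ` free_module m (b 1)"
    and "\<And>i. i \<ge> 1 \<Longrightarrow> {v \<in> free_module m (b i). mat_apply (b i) (A i) v = 0} =
      mat_apply (b (Suc i)) (A (Suc i)) ` free_module m (b (Suc i))"
proof -
  note res = assms[unfolded minimal_free_resolution_def]
  show "b 0 = 1" "D 1 0 = 0"
    using res by (simp_all only: simp_thms)
  have "\<forall>i\<ge>m. b i = 0"
    using res by (elim conjE)
  then show "b m = 0"
    by blast
  have "\<forall>i\<ge>1. graded_matrix m d (b (i - 1)) (\<lambda>j. D j (i - 1)) (b i) (\<lambda>j. D j i) (A i)"
    using res by (elim conjE)
  from this[rule_format, of "Suc i" for i]
  show "graded_matrix m d (b i) (\<lambda>j. D j i) (b (Suc i)) (\<lambda>j. D j (Suc i)) (A (Suc i))" for i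
    by simp
  show "{v \<in> free_module m (b 0). augmentation d (v 1) = 0} =
      mat_apply (b 1) (A 1) ` free_module m (b 1)"
    using res by (elim conjE)
  have "\<forall>i\<ge>1. {v \<in> free_module m (b i). mat_apply (b i) (A i) v = (\<lambda>_. 0)} =
      mat_apply (b (i + 1)) (A (i + 1)) ` free_module m (b (i + 1))"
    using res by (elim conjE)
  then show "{v \<in> free_module m (b i). mat_apply (b i) (A i) v = 0} =
      mat_apply (b (Suc i)) (A (Suc i)) ` free_module m (b (Suc i))" if "i \<ge> 1" for i
    using that by (simp add: zero_fun_def)
qed

text \<open>
  Exactness and rank-nullity express the dimension of each graded piece as a sum of two consecutive
  ranks. In the alternating sum the ranks telescope, and only the contribution of the semigroup ring
  remains.
\<close>
lemma hilbert_function_of_resolution: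
  fixes A :: "nat \<Rightarrow> nat \<Rightarrow> nat \<Rightarrow> 'k::field mpolynomial"
  assumes res: "minimal_free_resolution m d b D A" and "m \<ge> 1" and pos: "\<forall>i\<in>{1..m}. d i > 0"
  shows "(\<Sum>i\<le>m-1. (-1) ^ i *
      of_nat (\<Sum>j=1..b i. if D j i \<le> n then card (monomials m d (n - D j i)) else 0)) =
    (if n \<in> semigroup_gen m d then 1 else (0 :: rat))"
proof -
  define G :: "nat \<Rightarrow> (nat \<Rightarrow> 'k mpolynomial) set" where "G i = graded_piece m d (b i) (\<lambda>j. D j i) n" for i
  define f where "f i = mat_apply (b i) (A i)" for i
  define r where "r i = vec.dim (f i ` G i)" for i
  define s where "s = (if n \<in> semigroup_gen m d then 1 else 0 :: nat)"
  note resD = minimal_free_resolutionD[OF res]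
  have ker0: "{v \<in> G 0. augmentation d (v 1) = 0} = f 1 ` G 1"
    unfolding G_def f_def by (rule exact_on_graded_pieces[OF _ resD(5)]) (use resD(4)[of 0] in simp)
  have ker: "{v \<in> G i. f i v = 0} = f (Suc i) ` G (Suc i)" if "i \<ge> 1" for i
    unfolding G_def f_def by (rule exact_on_graded_pieces[OF resD(4) resD(6)[OF that]])
  have sub: "vec.subspace (G i)" for i
    unfolding G_def by (rule subspace_graded_piece)
  have fin: "\<exists>W. finite W \<and> G i \<subseteq> vec.span W" for i
    unfolding G_def by (rule dim_graded_piece(1)[OF pos])
  have dim0: "vec.dim (G 0) = r 1 + s"
  proof -
    obtain W where W: "finite W" "G 0 \<subseteq> vec.span W"
      using fin by blast
    have "vec.dim (G 0) = vec.dim {v \<in> G 0. augmentation d (v 1) = 0} +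
        poly_vec.dim ((\<lambda>v. augmentation d (v 1)) ` G 0)"
      by (rule linear.rank_nullity[OF linear_augmentation sub W(2,1)])
    moreover have "poly_vec.dim ((\<lambda>v. augmentation d (v 1)) ` G 0) = s"
      unfolding G_def s_def by (rule dim_augmentation_image) (simp_all only: resD(1,2))
    ultimately show ?thesis
      unfolding ker0 r_def by (simp only:)
  qed
  have dim: "vec.dim (G i) = r (Suc i) + r i" if "i \<ge> 1" for i
  proof -
    obtain W where W: "finite W" "G i \<subseteq> vec.span W"
      using fin by blast
    have "vec.dim (G i) = vec.dim {v \<in> G i. f i v = 0} + vec.dim (f i ` G i)"
      unfolding f_def by (rule linear.rank_nullity[OF linear_mat_apply sub W(2,1)])
    then show ?thesis
      unfolding ker[OF that] r_def .
  qed
  \<comment> \<open>The rank left over at stage \<open>k\<close> vanishes for \<open>k = m - 1\<close>, as there are no syzygies of kind \<open>m\<close>.\<close>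
  have telescope: "(\<Sum>i\<le>k. (-1) ^ i * of_nat (vec.dim (G i))) = of_nat s + (-1) ^ k * (of_nat (r (Suc k)) :: rat)" for k
    by (induction k) (simp_all add: dim0 dim algebra_simps)
  have "f m v = 0" for v
    unfolding f_def mat_apply_def resD(3) by (rule ext) simp
  then have "f m ` G m \<subseteq> vec.span {}"
    unfolding vec.span_empty by blast
  then have "r m = 0"
    unfolding r_def using vec.dim_le_card[of "f m ` G m" "{}"] by simp
  then have "(\<Sum>i\<le>m-1. (-1) ^ i * of_nat (vec.dim (G i))) = (of_nat s :: rat)"
    using telescope[of "m - 1"] \<open>m \<ge> 1\<close> by simp
  then show ?thesis
    unfolding s_def G_def dim_graded_piece(2)[OF pos] by simp
qed

text \<open>
  The previous count, summed over all degrees: a generator of degree \<open>c\<close> contributes \<open>z^c\<close> times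
  the Hilbert series of the polynomial ring.
\<close>
lemma hilbert_series_of_resolution:
  assumes "minimal_free_resolution m d b D A" and "m \<ge> 1" and pos: "\<forall>i\<in>{1..m}. d i > 0"
  shows "hilbert_series m d * (\<Prod>i=1..m. 1 - fps_X ^ d i) = fps_of_poly (numerator m b D)"
proof -
  let ?P = "Abs_fps (\<lambda>n. of_nat (card (monomials m d n))) :: rat fps"
  note b0 = minimal_free_resolutionD(1,2)[OF assms(1)]
  have "{..m - 1} = insert 0 {1..m - 1}"
    by auto
  then have num: "fps_of_poly (numerator m b D) = (\<Sum>i\<le>m-1. (-1) ^ i * (\<Sum>j=1..b i. fps_X ^ D j i))"
    using b0 by (simp add: numerator_def fps_of_poly_add fps_of_poly_sum fps_of_poly_mult
        fps_of_poly_power fps_of_poly_uminus fps_of_poly_monom')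
  have "hilbert_series m d = (\<Sum>i\<le>m-1. (-1) ^ i * (\<Sum>j=1..b i. fps_X ^ D j i)) * ?P"
  proof (rule fps_ext)
    fix n
    have sgn: "(((-1) ^ i * F :: rat fps) $ n) = (-1) ^ i * F $ n" for i F
      by (cases "even i") simp_all
    have "((\<Sum>i\<le>m-1. (-1) ^ i * (\<Sum>j=1..b i. fps_X ^ D j i)) * ?P) $ n =
        (\<Sum>i\<le>m-1. (-1) ^ i * (\<Sum>j=1..b i. (fps_X ^ D j i * ?P) $ n))"
      by (simp add: sum_distrib_right mult.assoc fps_sum_nth sgn)
    also have "\<dots> = (\<Sum>i\<le>m-1. (-1) ^ i *
        of_nat (\<Sum>j=1..b i. if D j i \<le> n then card (monomials m d (n - D j i)) else 0))"
      by (intro sum.cong refl arg_cong[where f = "(*) _"])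
        (auto simp: fps_X_power_mult_nth not_le intro!: sum.cong)
    also have "\<dots> = hilbert_series m d $ n"
      by (subst hilbert_function_of_resolution[OF assms]) (simp add: hilbert_series_def)
    finally show "hilbert_series m d $ n = ((\<Sum>i\<le>m-1. (-1) ^ i * (\<Sum>j=1..b i. fps_X ^ D j i)) * ?P) $ n" ..
  qed
  then show ?thesis
    using polynomial_ring_hilbert_series[OF pos] num by (simp add: mult.assoc)
qed

section \<open>Cancellation in the numerator\<close>

text \<open>
  The non-constant part of the numerator as a function of the multisets of degrees, the form in which
  cancellation acts on it.
\<close>
definition signed_degree_sum :: "nat \<Rightarrow> (nat \<Rightarrow> nat multiset) \<Rightarrow> rat poly" where
  "signed_degree_sum m X = (\<Sum>i=1..m-1. (-1) ^ i * (\<Sum>c\<in>#X i. monom 1 c))"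

lemma numerator_eq_signed_degree_sum:
  "numerator m \<beta> C = 1 + signed_degree_sum m (syzygy_degrees m \<beta> C)"
  unfolding numerator_def signed_degree_sum_def syzygy_degrees_def
  by (intro arg_cong2[where f = "(+)"] refl sum.cong)
    (simp_all add: image_mset.compositionality o_def sum_unfold_sum_mset)

text \<open>
  A cancellation removes \<open>z^c\<close> once with each sign. Both indices lie in \<open>{1..m-1}\<close>, where the sum sees
  them, because the multisets outside this range are empty; this property is an invariant.
\<close>
lemma cancel_step_signed_degree_sum:
  assumes step: "cancel_step X Y" and supp: "\<And>i. i \<notin> {1..m-1} \<Longrightarrow> X i = {#}"
  shows "signed_degree_sum m Y = signed_degree_sum m X"
    and "\<And>i. i \<notin> {1..m-1} \<Longrightarrow> Y i = {#}"
proof -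
  obtain i i' c where odd: "odd (i + i')" and c: "c \<in># X i" "c \<in># X i'"
    and Y: "Y = X(i := X i - {#c#}, i' := X i' - {#c#})"
    using step unfolding cancel_step_def by blast
  have mem: "i \<in> {1..m-1}" "i' \<in> {1..m-1}"
    using c supp by force+
  have "i \<noteq> i'"
    using odd by auto
  let ?S = "\<lambda>M. \<Sum>c\<in>#M. monom (1 :: rat) c"
  have remove: "?S (M - {#c#}) = ?S M - monom 1 c" if "c \<in># M" for M
    using insert_DiffM[OF that] by (metis add_diff_cancel_left' image_mset_add_mset sum_mset.add_mset)
  have "(-1) ^ l * ?S (Y l) = (-1) ^ l * ?S (X l)
      - (if l = i then (-1) ^ i * monom 1 c else 0) - (if l = i' then (-1) ^ i' * monom 1 c else 0)" for l
    unfolding Y using \<open>i \<noteq> i'\<close> remove c by (simp add: right_diff_distrib)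
  then have "signed_degree_sum m Y = signed_degree_sum m X - ((-1) ^ i + (-1) ^ i') * monom 1 c"
    using mem unfolding signed_degree_sum_def by (simp add: sum_subtractf distrib_right)
  moreover have "(-1) ^ i + (-1) ^ i' = (0 :: rat poly)"
    using odd by (cases "even i") auto
  ultimately show "signed_degree_sum m Y = signed_degree_sum m X"
    by simp
  show "Y l = {#}" if "l \<notin> {1..m-1}" for l
    unfolding Y using supp[OF that] mem that by auto
qed

lemma cancellation_preserves_signed_degree_sum:
  assumes "cancel_step\<^sup>*\<^sup>* X Y" and "\<And>i. i \<notin> {1..m-1} \<Longrightarrow> X i = {#}"
  shows "signed_degree_sum m Y = signed_degree_sum m X"
proof -
  have "signed_degree_sum m Y = signed_degree_sum m X \<and> (\<forall>i. i \<notin> {1..m-1} \<longrightarrow> Y i = {#})"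
    using assms(1)
  proof (induction rule: rtranclp_induct)
    case base
    then show ?case
      using assms(2) by blast
  next
    case (step Y Z)
    then show ?case
      using cancel_step_signed_degree_sum[of Y Z m] by simp
  qed
  then show ?thesis ..
qed

section \<open>Order of vanishing of the numerator at 1\<close>

lemma semigroup_gen_Suc:
  "semigroup_gen (Suc k) d = {a + x * d (Suc k) | a x. a \<in> semigroup_gen k d}"
proof -
  have "\<exists>y. (\<Sum>i=1..k. x i * d i) + a * d (Suc k) = (\<Sum>i=1..Suc k. y i * d i)" for x a
    by (rule exI[of _ "x(Suc k := a)"]) (auto intro!: sum.cong)
  moreover have "(\<Sum>i=1..Suc k. y i * d i) = (\<Sum>i=1..k. y i * d i) + y (Suc k) * d (Suc k)" for y
    by simp
  ultimately show ?thesis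
    unfolding semigroup_gen_def by blast
qed

text \<open>
  Induction on the number of generators. A multiple \<open>n\<close> of the new gcd differs by \<open>x * d (Suc k)\<close> from a
  multiple of the old gcd \<open>g\<close>, for some \<open>x < g\<close> found by solving a linear congruence. As \<open>x\<close> is bounded,
  the difference stays large.
\<close>
lemma semigroup_gen_contains_large_multiples:
  assumes "k \<ge> 1" "\<forall>i\<in>{1..k}. d i > 0"
  shows "\<exists>N. \<forall>n\<ge>N. Gcd (d ` {1..k}) dvd n \<longrightarrow> n \<in> semigroup_gen k d"
  using assms
proof (induction k rule: nat_induct_at_least)
  case base
  have "n \<in> semigroup_gen 1 d" if "d 1 dvd n" for n
    using that unfolding semigroup_gen_def
    by (auto simp: dvd_def mult.commute intro!: exI[of _ "\<lambda>_. n div d 1"])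
  then show ?case
    by auto
next
  case (Suc k)
  let ?g = "Gcd (d ` {1..k})" and ?e = "d (Suc k)"
  obtain N where N: "\<And>n. n \<ge> N \<Longrightarrow> ?g dvd n \<Longrightarrow> n \<in> semigroup_gen k d"
    using Suc by auto
  have "d 1 > 0" "d 1 \<in> d ` {1..k}"
    using Suc.prems \<open>1 \<le> k\<close> by auto
  then have "?g > 0"
    by (metis Gcd_0_iff gr0I singletonD subsetD less_irrefl)
  have Gcd_Suc: "Gcd (d ` {1..Suc k}) = gcd ?e ?g"
    by (simp add: atLeastAtMostSuc_conv)
  have "n \<in> semigroup_gen (Suc k) d" if n: "n \<ge> N + ?g * ?e" "gcd ?e ?g dvd n" for n
  proof -
    obtain q where q: "n = gcd ?e ?g * q"
      using n(2) by blast
    obtain y where "[?e * y = gcd ?e ?g] (mod ?g)"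
      using cong_solve_nat[of ?e ?g] Suc.prems by auto
    then have "[?e * y * q = n] (mod ?g)"
      unfolding q by (rule cong_scalar_right)
    moreover define x where "x = y * q mod ?g"
    have "[?e * x = ?e * y * q] (mod ?g)"
      unfolding x_def cong_def by (simp add: mod_mult_right_eq mult.assoc)
    ultimately have "[?e * x = n] (mod ?g)"
      using cong_trans by blast
    moreover have "x < ?g"
      unfolding x_def using \<open>?g > 0\<close> by simp
    then have "?e * x \<le> ?g * ?e"
      by (simp add: mult.commute)
    then have "n - ?e * x \<ge> N" "?e * x \<le> n"
      using n(1) by linarith+
    ultimately have "?g dvd n - ?e * x"
      using cong_altdef_nat cong_sym by blast
    then show ?thesis
      unfolding semigroup_gen_Suc using N[of "n - ?e * x"] \<open>n - ?e * x \<ge> N\<close> \<open>?e * x \<le> n\<close>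
      by (intro CollectI exI[of _ "n - ?e * x"] exI[of _ x]) (simp add: \<open>?g dvd n - ?e * x\<close> mult.commute)
  qed
  then show ?case
    unfolding Gcd_Suc by blast
qed

text \<open>
  Beyond some \<open>N\<close> all coefficients of the Hilbert series are 1, so it is a polynomial plus
  \<open>z^N/(1 - z)\<close>. Multiplying by \<open>1 - z\<close> makes the first summand vanish at 1 and turns the second one
  into \<open>z^N\<close>.
\<close>
lemma hilbert_series_times_one_minus_X:
  assumes "m \<ge> 1" "\<forall>i\<in>{1..m}. d i > 0" "Gcd (d ` {1..m}) = 1"
  obtains P where "hilbert_series m d * (1 - fps_X) = fps_of_poly P" "poly P 1 = 1"
proof -
  let ?S = "semigroup_gen m d"
  obtain N where N: "\<And>n. n \<ge> N \<Longrightarrow> n \<in> ?S"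
    using semigroup_gen_contains_large_multiples[OF assms(1,2)] assms(3) by auto
  define E :: "rat poly" where "E = (\<Sum>s\<in>?S \<inter> {..<N}. monom 1 s)"
  have E: "coeff E n = (if n \<in> ?S \<inter> {..<N} then 1 else 0)" for n
    unfolding E_def by (simp add: coeff_sum)
  have "hilbert_series m d = fps_of_poly E + fps_X ^ N * Abs_fps (\<lambda>_. 1)"
    by (rule fps_ext) (auto simp: hilbert_series_def E fps_X_power_mult_nth N not_less)
  moreover have "Abs_fps (\<lambda>_. 1 :: rat) * (1 - fps_X) = 1"
    by (simp flip: fps_inverse_gp' add: inverse_mult_eq_1')
  ultimately have "hilbert_series m d * (1 - fps_X) = fps_of_poly (E * [:1, -1:] + monom 1 N)"
    by (simp add: fps_of_poly_add fps_of_poly_mult fps_of_poly_monom' fps_of_poly_pCons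
        distrib_right mult.assoc)
  then show ?thesis
    by (rule that) (simp add: poly_monom)
qed

text \<open>
  The \<open>m\<close> factors \<open>1 - z^(d i)\<close> each have a simple zero at 1, and the simple pole of the Hilbert series
  removes one of them.
\<close>
lemma numerator_vanishes_to_order:
  fixes Q :: "rat poly"
  assumes "m \<ge> 1" "\<forall>i\<in>{1..m}. d i > 0" "Gcd (d ` {1..m}) = 1"
    and Q: "fps_of_poly Q = hilbert_series m d * (\<Prod>i=1..m. 1 - fps_X ^ d i)"
  obtains G where "Q = [:1, -1:] ^ (m - 1) * G" "poly G 1 = (\<Prod>i=1..m. of_nat (d i))"
proof -
  obtain P where P: "hilbert_series m d * (1 - fps_X) = fps_of_poly P" "poly P 1 = 1"
    using hilbert_series_times_one_minus_X[OF assms(1-3)] .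
  \<comment> \<open>\<open>\<Psi> e\<close> is the quotient of \<open>1 - z^e\<close> by \<open>1 - z\<close>.\<close>
  define \<Psi> :: "nat \<Rightarrow> rat poly" where "\<Psi> e = (\<Sum>k<e. [:0, 1:] ^ k)" for e
  have "fps_X ^ e = fps_of_poly ([:0, 1 :: rat:] ^ e)" for e
    by (simp add: fps_of_poly_power fps_of_poly_pCons)
  moreover have "1 - [:0, 1 :: rat:] ^ e = [:1, -1:] * \<Psi> e" for e
    using one_diff_power_eq[of "[:0, 1 :: rat:]" e] unfolding \<Psi>_def by (simp add: one_pCons)
  ultimately have prod: "(\<Prod>i=1..m. 1 - fps_X ^ d i) = fps_of_poly (\<Prod>i=1..m. [:1, -1:] * \<Psi> (d i))"
    by (simp only: fps_of_poly_prod fps_of_poly_diff[symmetric] fps_of_poly_1[symmetric])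
  have X: "1 - fps_X = fps_of_poly [:1, -1 :: rat:]"
    by (rule fps_ext) (simp add: coeff_pCons fps_X_def split: nat.split)
  have "fps_of_poly (Q * [:1, -1:]) = fps_of_poly (P * (\<Prod>i=1..m. [:1, -1:] * \<Psi> (d i)))"
    unfolding fps_of_poly_mult[of _ "[:1, -1:]"] fps_of_poly_mult[of P] Q prod P(1)[symmetric] X
    by (simp only: mult_ac)
  then have "Q * [:1, -1:] = P * ([:1, -1:] ^ m * (\<Prod>i=1..m. \<Psi> (d i)))"
    unfolding fps_of_poly_eq_iff prod.distrib by (simp only: prod_constant card_atLeastAtMost diff_Suc_1)
  also have "[:1, -1 :: rat:] ^ m = [:1, -1:] ^ (m - 1) * [:1, -1:]"
    using \<open>m \<ge> 1\<close> by (cases m) simp_all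
  finally have "Q * [:1, -1:] = [:1, -1:] ^ (m - 1) * (P * (\<Prod>i=1..m. \<Psi> (d i))) * [:1, -1:]"
    by (simp only: mult_ac)
  then have "Q = [:1, -1:] ^ (m - 1) * (P * (\<Prod>i=1..m. \<Psi> (d i)))"
    by (subst (asm) mult_cancel_right) simp
  moreover have "poly (\<Psi> e) 1 = of_nat e" for e
    unfolding \<Psi>_def by (simp add: poly_sum)
  ultimately show ?thesis
    by (intro that[of "P * (\<Prod>i=1..m. \<Psi> (d i))"]) (simp_all add: P(2) poly_prod)
qed

section \<open>The Euler operator and power sums\<close>

definition euler :: "rat poly \<Rightarrow> rat poly" where
  "euler p = pCons 0 (pderiv p)"

lemma euler_add: "euler (p + q) = euler p + euler q"
  by (simp add: euler_def pderiv_add)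

lemma euler_smult: "euler (smult a p) = smult a (euler p)"
  by (simp add: euler_def pderiv_smult)

lemma euler_funpow_add: "(euler ^^ r) (p + q) = (euler ^^ r) p + (euler ^^ r) q"
  by (induction r) (simp_all add: euler_add)

lemma euler_funpow_smult: "(euler ^^ r) (smult a p) = smult a ((euler ^^ r) p)"
  by (induction r) (simp_all add: euler_smult)

lemma euler_funpow_0: "(euler ^^ r) 0 = 0"
  by (induction r) (simp_all add: euler_def)

lemma euler_funpow_sum: "(euler ^^ r) (sum f A) = (\<Sum>a\<in>A. (euler ^^ r) (f a))"
  by (induction A rule: infinite_finite_induct) (simp_all add: euler_funpow_add euler_funpow_0)

lemma euler_monom: "euler (monom a c) = monom (of_nat c * a) c"
  by (cases c) (simp_all add: euler_def pderiv_monom flip: monom_Suc)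

lemma euler_funpow_monom: "(euler ^^ r) (monom a c) = monom (of_nat c ^ r * a) c"
  by (induction r) (simp_all add: euler_monom mult_ac)

text \<open>
  Induction on the order: \<open>\<theta>((1 - z)^(k+1) G) = (1 - z)^k G'\<close> with
  \<open>G' = -(k + 1) z G + z (1 - z) dG/dz\<close>, so \<open>G'(1) = -(k + 1) G(1)\<close>.
\<close>
lemma euler_funpow_at_zero_of_order:
  fixes G :: "rat poly"
  shows "r < k \<Longrightarrow> poly ((euler ^^ r) ([:1, -1:] ^ k * G)) 1 = 0"
    and "poly ((euler ^^ k) ([:1, -1:] ^ k * G)) 1 = (-1) ^ k * fact k * poly G 1"
proof (induction k arbitrary: r G)
  case (Suc k)
  define G' where "G' H = [:0, -1:] * smult (of_nat (Suc k)) H + [:0, 1:] * [:1, -1:] * pderiv H"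
    for H :: "rat poly"
  have euler_eq: "euler p = [:0, 1:] * pderiv p" for p
    by (simp add: euler_def)
  have step: "euler ([:1, -1:] ^ Suc k * H) = [:1, -1:] ^ k * G' H" for H
    unfolding euler_eq G'_def
    by (simp only: pderiv_mult pderiv_power_Suc pderiv_pCons) (simp add: algebra_simps)
  have funpow_step: "(euler ^^ Suc l) ([:1, -1:] ^ Suc k * H) = (euler ^^ l) ([:1, -1:] ^ k * G' H)" for l H
    by (simp only: funpow_Suc_right o_def step)
  have val: "poly (G' H) 1 = - of_nat (Suc k) * poly H 1" for H
    by (simp add: G'_def algebra_simps)
  { case 1
    show ?case
    proof (cases r)
      case (Suc r')
      then show ?thesis
        using 1 Suc.IH(1) by (simp only: funpow_step Suc_less_eq)
    qed simp
  next
    case 2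
    show ?case
      unfolding funpow_step Suc.IH(2) val by (simp add: algebra_simps)
  }
qed simp_all

text \<open>
  Powers of the Euler operator at 1 extract power sums of exponents; for \<open>r \<ge> 1\<close> the constant term of
  the numerator drops out.
\<close>
lemma euler_funpow_numerator_at_one:
  assumes "r \<ge> 1"
  shows "poly ((euler ^^ r) (numerator m \<beta> C)) 1 = (\<Sum>i=1..m-1. (-1) ^ i * (\<Sum>j=1..\<beta> i. of_nat (C j i) ^ r))"
proof -
  have neg: "(-1) ^ i * p = smult ((-1) ^ i) p" for i and p :: "rat poly"
    by (cases "even i") simp_all
  have one: "(euler ^^ r) 1 = 0"
    using euler_funpow_monom[of r 1 0] assms by (simp add: monom_0 one_pCons power_0_left)
  show ?thesis
    unfolding numerator_def neg
    by (simp add: euler_funpow_add euler_funpow_sum euler_funpow_smult euler_funpow_monom one poly_sum poly_monom)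
qed

theorem theorem1:
  fixes m :: nat and d b \<beta> :: "nat \<Rightarrow> nat" and D C :: "nat \<Rightarrow> nat \<Rightarrow> nat"
    and A :: "nat \<Rightarrow> nat \<Rightarrow> nat \<Rightarrow> 'k::field mpolynomial"
  assumes "m \<ge> 3"
    and "minimal_generators m d"
    and "minimal_free_resolution m d b D A"
    and "\<forall>i\<in>{1..m-1}. mono_on {1..\<beta> i} (\<lambda>j. C j i)"
    and "syzygy_degrees m \<beta> C = syzygy_degrees m b D \<or>
         fully_cancelled m (syzygy_degrees m b D) (syzygy_degrees m \<beta> C)"
  shows "hilbert_series m d = fps_of_poly (numerator m \<beta> C) / (\<Prod>i=1..m. 1 - fps_X ^ d i) \<and>
    (\<forall>r\<in>{1..m-2}. (\<Sum>i=1..m-1. (-1)^(i-1) * (\<Sum>j=1..\<beta> i. int (C j i) ^ r)) = 0) \<and>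
    (\<Sum>i=1..m-1. (-1)^(i-1) * (\<Sum>j=1..\<beta> i. int (C j i) ^ (m-1)))
      = (-1)^m * fact (m-1) * (\<Prod>i=1..m. int (d i))"
proof -
  define Q where "Q = numerator m \<beta> C"
  define F :: "rat fps" where "F = (\<Prod>i=1..m. 1 - fps_X ^ d i)"
  have m: "m \<ge> 1" and pos: "\<forall>i\<in>{1..m}. d i > 0" and gcd: "Gcd (d ` {1..m}) = 1"
    using assms(1,2) unfolding minimal_generators_def by auto
  have "signed_degree_sum m (syzygy_degrees m \<beta> C) = signed_degree_sum m (syzygy_degrees m b D)"
    using assms(5)
  proof
    assume "fully_cancelled m (syzygy_degrees m b D) (syzygy_degrees m \<beta> C)"
    then show ?thesis
      unfolding fully_cancelled_def
      by (intro cancellation_preserves_signed_degree_sum) (auto simp: syzygy_degrees_def)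
  qed simp
  then have "Q = numerator m b D"
    unfolding Q_def numerator_eq_signed_degree_sum by simp
  then have HF: "fps_of_poly Q = hilbert_series m d * F"
    using hilbert_series_of_resolution[OF assms(3) m pos] unfolding F_def by simp
  have "(1 - fps_X ^ e :: rat fps) $ 0 = 1" if "e > 0" for e
    using that by (simp add: fps_X_power_nth)
  then have "1 - fps_X ^ e \<noteq> (0 :: rat fps)" if "e > 0" for e
    using that by (metis fps_zero_nth zero_neq_one)
  then have "F \<noteq> 0"
    unfolding F_def using pos by simp
  then have series: "hilbert_series m d = fps_of_poly Q / F"
    unfolding HF by simp

  obtain G where G: "Q = [:1, -1:] ^ (m - 1) * G" "poly G 1 = (\<Prod>i=1..m. of_nat (d i))"
    using numerator_vanishes_to_order[OF m pos gcd] HF unfolding F_def by metis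
  have power_sum: "of_int (\<Sum>i=1..m-1. (-1) ^ (i - 1) * (\<Sum>j=1..\<beta> i. int (C j i) ^ r)) =
      - poly ((euler ^^ r) Q) 1" if "r \<ge> 1" for r
  proof -
    have "(-1) ^ (i - 1) = - ((-1) ^ i :: rat)" if "i \<in> {1..m-1}" for i
      using that by (cases i) auto
    then show ?thesis
      unfolding Q_def euler_funpow_numerator_at_one[OF that] by (simp add: sum_negf)
  qed
  have "(\<Sum>i=1..m-1. (-1) ^ (i - 1) * (\<Sum>j=1..\<beta> i. int (C j i) ^ r)) = 0" if "r \<in> {1..m-2}" for r
  proof -
    have "poly ((euler ^^ r) Q) 1 = 0"
      unfolding G(1) using that by (intro euler_funpow_at_zero_of_order(1)) auto
    then show ?thesis
      using power_sum[of r] that by (simp only: of_int_eq_0_iff minus_zero atLeastAtMost_iff)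
  qed
  moreover have "(\<Sum>i=1..m-1. (-1) ^ (i - 1) * (\<Sum>j=1..\<beta> i. int (C j i) ^ (m - 1))) =
      (-1) ^ m * fact (m - 1) * (\<Prod>i=1..m. int (d i))"
  proof -
    have sign: "(-1) ^ m = - ((-1) ^ (m - 1) :: rat)"
      using m by (cases m) auto
    have "- poly ((euler ^^ (m - 1)) Q) 1 = of_int ((-1) ^ m * fact (m - 1) * (\<Prod>i=1..m. int (d i)))"
      unfolding G(1) euler_funpow_at_zero_of_order(2) G(2) by (simp add: sign)
    then show ?thesis
      using power_sum[of "m - 1"] assms(1) by (simp only: of_int_eq_iff)
  qed
  ultimately show ?thesis
    using series unfolding Q_def F_def by blast
qed

end
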